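(* Let $k\ge 3$ and let $G$ be a minimal $k$-cross-theta. Every circle in $G$ is negative if and only if $G$ is switching equivalent to a balanced subdivision of an extroverted or introverted $L_k$.
   Context: An oriented hypergraph is a quintuple $G=(V,E,I,\iota,\sigma)$ with finite sets of vertices $V$, edges $E$, incidences $I$, an incidence function $\iota:I\to V\times E$ (not necessarily injective), and an orientation $\sigma:I\to\{+1,-1\}$. A path of length $n/2$ is a non-repeating sequence $(a_0,i_1,a_1,\dots,i_n,a_n)$, where the $a_k$ alternate between vertices and edges and $i_k$ is an incidence between $a_{k-1}$ and $a_k$. A circle is a closed path (a cycle of the bipartite multigraph with vertex set $V\cup E$ and edge set $I$). The sign of a circle with $n$ incidences is $(-1)^{\lfloor n/2\rfloor}\prod_{k=1}^n\sigma(i_k)$. A $k$-cross-theta ($k\ge3$) consists of $k$ internally disjoint paths of half-integer length with common end-points (one a vertex, one an edge); it is minimal if it consists of exactly these $k$ paths and nothing else. $L_k$ is the hypergraph with a single vertex, a single edge and $k$ incidences between them; it is extroverted if every incidence is $+1$ and introverted if every incidence is $-1$. A subdivision of an edge $e$ replaces $e$ by two edges $e_1,e_2$, a new vertex $w$ and two new incidences $j_1,j_2$ at $w$ with $j_1\in I(e_1)$, $j_2\in I(e_2)$, $I(e_1)\cap I(e_2)=\emptyset$ and $(I(e_1)\setminus j_1)\cup(I(e_2)\setminus j_2)=I(e)$, where $I(x)$ is the set of incidences of $x$; the term is also used for iterated subdivisions (including none). A balanced subdivision is one in which the signs of corresponding circles do not change. Switching a vertex (resp. edge) negates $\sigma$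 on all incidences at that vertex (resp. edge); two orientations are switching equivalent if one is obtained from the other by a sequence of vertex and edge switchings. *)

theory Defs
  imports Main
begin

record ('v, 'e, 'i) ohg =
  verts :: "'v set"
  edges :: "'e set"
  incs :: "'i set"
  incf :: "'i \<Rightarrow> 'v \<times> 'e"
  orient :: "'i \<Rightarrow> int"

definition oriented_hypergraph :: "('v, 'e, 'i) ohg \<Rightarrow> bool" where
  "oriented_hypergraph G \<longleftrightarrow>
     finite (verts G) \<and> finite (edges G) \<and> finite (incs G) \<and>
     (\<forall>i\<in>incs G. incf G i \<in> verts G \<times> edges G) \<and>
     (\<forall>i\<in>incs G. orient G i \<in> {1, -1})"

definition incs_vert :: "('v, 'e, 'i) ohg \<Rightarrow> 'v \<Rightarrow> 'i set" where
  "incs_vert G v = {i \<in> incs G. fst (incf G i) = v}"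

definition incs_edge :: "('v, 'e, 'i) ohg \<Rightarrow> 'e \<Rightarrow> 'i set" where
  "incs_edge G e = {i \<in> incs G. snd (incf G i) = e}"


text \<open>A sequence \<open>a\<^sub>0, i\<^sub>1, a\<^sub>1, \<dots>, i\<^sub>n, a\<^sub>n\<close> is encoded as the pair of lists
  \<open>[a\<^sub>0, \<dots>, a\<^sub>n]\<close> and \<open>[i\<^sub>1, \<dots>, i\<^sub>n]\<close>; the sum type keeps vertices (\<open>Inl\<close>) and edges
  (\<open>Inr\<close>) apart.  Its length is \<open>n / 2\<close>, so it is a half-integer exactly if \<open>n\<close> is odd.\<close>

definition joins :: "('v, 'e, 'i) ohg \<Rightarrow> 'v + 'e \<Rightarrow> 'i \<Rightarrow> 'v + 'e \<Rightarrow> bool" where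
  "joins G a i b \<longleftrightarrow> i \<in> incs G \<and>
     (a = Inl (fst (incf G i)) \<and> b = Inr (snd (incf G i)) \<or>
      a = Inr (snd (incf G i)) \<and> b = Inl (fst (incf G i)))"

definition walk :: "('v, 'e, 'i) ohg \<Rightarrow> ('v + 'e) list \<Rightarrow> 'i list \<Rightarrow> bool" where
  "walk G ns js \<longleftrightarrow>
     length ns = Suc (length js) \<and>
     set ns \<subseteq> Inl ` verts G \<union> Inr ` edges G \<and>
     (\<forall>m < length js. joins G (ns ! m) (js ! m) (ns ! Suc m))"

definition path :: "('v, 'e, 'i) ohg \<Rightarrow> ('v + 'e) list \<Rightarrow> 'i list \<Rightarrow> bool" where
  "path G ns js \<longleftrightarrow> walk G ns js \<and> distinct ns \<and> distinct js"

definition circle :: "('v, 'e, 'i) ohg \<Rightarrow> ('v + 'e) list \<Rightarrow> 'i list \<Rightarrow> bool" where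
  "circle G ns js \<longleftrightarrow>
     walk G ns js \<and> js \<noteq> [] \<and> hd ns = last ns \<and> distinct (tl ns) \<and> distinct js"

definition circle_sign :: "('v, 'e, 'i) ohg \<Rightarrow> 'i list \<Rightarrow> int" where
  "circle_sign G js = (-1) ^ (length js div 2) * (\<Prod>i\<leftarrow>js. orient G i)"


text \<open>The incidences of a path count as part of its interior; without this, the same path
  with a single incidence could be listed several times.\<close>

definition cross_theta_paths ::
  "('v, 'e, 'i) ohg \<Rightarrow> nat \<Rightarrow> (nat \<Rightarrow> ('v + 'e) list \<times> 'i list) \<Rightarrow> bool" where
  "cross_theta_paths G k P \<longleftrightarrow>
     k \<ge> 3 \<and>
     (\<exists>x\<in>verts G. \<exists>y\<in>edges G. \<forall>p<k.
        path G (fst (P p)) (snd (P p)) \<and> odd (length (snd (P p))) \<and>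
        hd (fst (P p)) = Inl x \<and> last (fst (P p)) = Inr y) \<and>
     (\<forall>p<k. \<forall>q<k. p \<noteq> q \<longrightarrow>
        set (butlast (tl (fst (P p)))) \<inter> set (butlast (tl (fst (P q)))) = {} \<and>
        set (snd (P p)) \<inter> set (snd (P q)) = {})"

definition minimal_cross_theta :: "nat \<Rightarrow> ('v, 'e, 'i) ohg \<Rightarrow> bool" where
  "minimal_cross_theta k G \<longleftrightarrow>
     oriented_hypergraph G \<and>
     (\<exists>P. cross_theta_paths G k P \<and>
        Inl ` verts G \<union> Inr ` edges G = (\<Union>p<k. set (fst (P p))) \<and>
        incs G = (\<Union>p<k. set (snd (P p))))"

definition is_L :: "nat \<Rightarrow> ('v, 'e, 'i) ohg \<Rightarrow> bool" where
  "is_L k G \<longleftrightarrow>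
     oriented_hypergraph G \<and> card (verts G) = 1 \<and> card (edges G) = 1 \<and> card (incs G) = k"

definition extroverted :: "('v, 'e, 'i) ohg \<Rightarrow> bool" where
  "extroverted G \<longleftrightarrow> (\<forall>i\<in>incs G. orient G i = 1)"

definition introverted :: "('v, 'e, 'i) ohg \<Rightarrow> bool" where
  "introverted G \<longleftrightarrow> (\<forall>i\<in>incs G. orient G i = -1)"


text \<open>Since \<open>e\<close> disappears, its name may be reused for \<open>e\<^sub>1\<close> or \<open>e\<^sub>2\<close>; the two must only be
  distinct and differ from the remaining edges.  An incidence of \<open>e\<close> keeps its vertex and
  orientation and is passed on to \<open>e\<^sub>1\<close> or \<open>e\<^sub>2\<close>; all other incidences are unchanged.\<close>

definition subdivides_edge :: "('v, 'e, 'i) ohg \<Rightarrow> ('v, 'e, 'i) ohg \<Rightarrow> bool" where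
  "subdivides_edge G H \<longleftrightarrow>
     oriented_hypergraph G \<and> oriented_hypergraph H \<and>
     (\<exists>e e\<^sub>1 e\<^sub>2 w j\<^sub>1 j\<^sub>2.
        e \<in> edges G \<and> e\<^sub>1 \<noteq> e\<^sub>2 \<and> e\<^sub>1 \<notin> edges G - {e} \<and> e\<^sub>2 \<notin> edges G - {e} \<and>
        w \<notin> verts G \<and> j\<^sub>1 \<noteq> j\<^sub>2 \<and> j\<^sub>1 \<notin> incs G \<and> j\<^sub>2 \<notin> incs G \<and>
        verts H = verts G \<union> {w} \<and>
        edges H = (edges G - {e}) \<union> {e\<^sub>1, e\<^sub>2} \<and>
        incs H = incs G \<union> {j\<^sub>1, j\<^sub>2} \<and>
        incs_vert H w = {j\<^sub>1, j\<^sub>2} \<and>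
        j\<^sub>1 \<in> incs_edge H e\<^sub>1 \<and> j\<^sub>2 \<in> incs_edge H e\<^sub>2 \<and>
        incs_edge H e\<^sub>1 \<inter> incs_edge H e\<^sub>2 = {} \<and>
        (incs_edge H e\<^sub>1 - {j\<^sub>1}) \<union> (incs_edge H e\<^sub>2 - {j\<^sub>2}) = incs_edge G e \<and>
        (\<forall>i\<in>incs G. orient H i = orient G i \<and> fst (incf H i) = fst (incf G i)) \<and>
        (\<forall>i\<in>incs G - incs_edge G e. snd (incf H i) = snd (incf G i)))"

definition subdivision :: "('v, 'e, 'i) ohg \<Rightarrow> ('v, 'e, 'i) ohg \<Rightarrow> bool" where
  "subdivision = subdivides_edge\<^sup>*\<^sup>*"

text \<open>Subdividing keeps all old incidences, so a circle of a subdivision \<open>H\<close> of \<open>G\<close> corresponds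
  to the circle of \<open>G\<close> that remains when the new incidences are left out.\<close>

definition balanced_subdivision :: "('v, 'e, 'i) ohg \<Rightarrow> ('v, 'e, 'i) ohg \<Rightarrow> bool" where
  "balanced_subdivision G H \<longleftrightarrow>
     subdivision G H \<and>
     (\<forall>ns js ns' js'.
        circle G ns js \<and> circle H ns' js' \<and> set js = set js' \<inter> incs G \<longrightarrow>
        circle_sign H js' = circle_sign G js)"

definition switch_vert :: "'v \<Rightarrow> ('v, 'e, 'i) ohg \<Rightarrow> ('v, 'e, 'i) ohg" where
  "switch_vert v G =
     G\<lparr>orient := (\<lambda>i. if i \<in> incs_vert G v then - orient G i else orient G i)\<rparr>"

definition switch_edge :: "'e \<Rightarrow> ('v, 'e, 'i) ohg \<Rightarrow> ('v, 'e, 'i) ohg" where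
  "switch_edge e G =
     G\<lparr>orient := (\<lambda>i. if i \<in> incs_edge G e then - orient G i else orient G i)\<rparr>"

inductive switching_equivalent :: "('v, 'e, 'i) ohg \<Rightarrow> ('v, 'e, 'i) ohg \<Rightarrow> bool" where
  refl: "switching_equivalent G G"
| vert: "switching_equivalent G H \<Longrightarrow> v \<in> verts H \<Longrightarrow> switching_equivalent G (switch_vert v H)"
| edge: "switching_equivalent G H \<Longrightarrow> e \<in> edges H \<Longrightarrow> switching_equivalent G (switch_edge e H)"

end

theory Submission
  imports Defs
begin

text \<open>Every vertex created by subdividing \<open>L\<^sub>k\<close> has degree two, and the incidences away from the
  original vertex \<open>x\<close> form a forest; conversely, such a hypergraph is contracted to \<open>L\<^sub>k\<close>
  by merging the two edges at a vertex other than \<open>x\<close>, provided the forest is a tree, that is, has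
  as many edges as vertices (counting \<open>x\<close>).  Hence a circle of a subdivision uses exactly two
  incidences at \<open>x\<close>, which form a circle of \<open>L\<^sub>k\<close>, and circles in an extroverted or introverted
  \<open>L\<^sub>k\<close> are negative.  Switching does not change signs of circles.  In the other direction, if
  all circles are negative, then two incidences of \<open>x\<close> with the same edge have the same sign, so
  that switching edges makes all incidences at \<open>x\<close> positive; the remaining signs are arbitrary
  for a subdivision of the extroverted \<open>L\<^sub>k\<close>.\<close>

section \<open>Circles and the incidences at a node\<close>

text \<open>Vertices and edges are treated alike as nodes of the bipartite incidence graph, so that
  degrees along circles, leaves and both kinds of switching need only one argument.\<close>

definition incs_at :: "('v, 'e, 'i) ohg \<Rightarrow> 'v + 'e \<Rightarrow> 'i set" where
  "incs_at G a = {i \<in> incs G. a = Inl (fst (incf G i)) \<or> a = Inr (snd (incf G i))}"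

lemma incs_at_simps [simp]:
  "incs_at G (Inl v) = incs_vert G v" "incs_at G (Inr e) = incs_edge G e"
  by (auto simp: incs_at_def incs_vert_def incs_edge_def)

text \<open>The incidences not at \<open>x\<close> form a forest, expressed by the existence of leaves.\<close>

definition acyclic_off :: "('v, 'e, 'i) ohg \<Rightarrow> 'v \<Rightarrow> bool" where
  "acyclic_off G x \<longleftrightarrow>
     (\<forall>S. S \<subseteq> incs G - incs_vert G x \<longrightarrow> S \<noteq> {} \<longrightarrow> (\<exists>a i. S \<inter> incs_at G a = {i}))"

lemma acyclic_offD:
  "acyclic_off G x \<Longrightarrow> S \<subseteq> incs G - incs_vert G x \<Longrightarrow> S \<noteq> {} \<Longrightarrow> \<exists>a i. S \<inter> incs_at G a = {i}"
  by (simp add: acyclic_off_def)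

lemma joins_ends:
  assumes "joins G a i b"
  shows "i \<in> incs G" "i \<in> incs_at G c \<longleftrightarrow> c = a \<or> c = b" "a \<noteq> b"
  using assms by (auto simp: joins_def incs_at_def)

text \<open>A circle with a single incidence would be a loop, but an incidence always joins a vertex
  to an edge.\<close>

lemma circle_length:
  assumes "circle G ns js"
  shows "length js \<ge> 2"
proof (rule ccontr)
  assume "\<not> ?thesis"
  then have l: "length js = 1" using assms by (auto simp: circle_def not_le less_2_cases_iff)
  then have "length ns = 2" and j: "joins G (ns!0) (js!0) (ns!1)"
    using assms by (auto simp: circle_def walk_def)
  then have "hd ns = ns!0" "last ns = ns!1"
    by (auto simp: hd_conv_nth last_conv_nth simp flip: length_greater_0_conv)
  then show False using joins_ends(3)[OF j] assms by (auto simp: circle_def)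
qed

text \<open>A circle passes through each of its nodes exactly once, entering by one incidence and
  leaving by another. Invariance of signs under switching and the contradiction with leaves both
  rest on this count.\<close>

lemma circle_incs_at:
  assumes "circle G ns js" and "i \<in> set js" and "i \<in> incs_at G a"
  shows "card (set js \<inter> incs_at G a) = 2"
proof -
  define n where "n = length js"
  have n2: "n \<ge> 2" using circle_length[OF assms(1)] by (simp add: n_def)
  have len: "length ns = Suc n" and j: "\<And>m. m < n \<Longrightarrow> joins G (ns!m) (js!m) (ns!Suc m)"
    and d: "distinct (tl ns)" and dj: "distinct js" and hl: "hd ns = last ns"
    using assms(1) by (auto simp: circle_def walk_def n_def)
  have ends: "ns ! 0 = ns ! n"
    using hl len by (simp add: hd_conv_nth last_conv_nth flip: length_greater_0_conv)
  have inj: "s = t" if "ns ! s = ns ! t" "0 < s" "s \<le> n" "0 < t" "t \<le> n" for s t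
  proof -
    have "tl ns ! (s - 1) = tl ns ! (t - 1)" using that len by (simp add: nth_tl)
    then have "s - 1 = t - 1" using d that len by (subst (asm) nth_eq_iff_index_eq) auto
    then show ?thesis using that by simp
  qed
  have at: "js ! m \<in> incs_at G c \<longleftrightarrow> c = ns ! m \<or> c = ns ! Suc m" if "m < n" for m c
    using joins_ends(2)[OF j[OF that]] .
  obtain m where m: "m < n" "js ! m = i" using assms(2) by (auto simp: in_set_conv_nth n_def)
  \<comment> \<open>The base node of the closed sequence stands at both index 0 and index
    \<open>n\<close>. Index \<open>n\<close> is chosen, because the nodes are pairwise distinct on
    the indices 1 to \<open>n\<close>.\<close>
  have "\<exists>t. 0 < t \<and> t \<le> n \<and> a = ns ! t"
  proof (cases "a = ns ! Suc m")
    case True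
    then show ?thesis using m by (intro exI[of _ "Suc m"]) auto
  next
    case False
    then have "a = ns ! m" using at[OF m(1)] m assms(3) by auto
    then show ?thesis using m ends n2 by (cases m) (auto intro: exI[of _ n] exI[of _ m])
  qed
  then obtain t where t: "0 < t" "t \<le> n" "a = ns ! t" by blast
  \<comment> \<open>The circle enters \<open>a\<close> by \<open>js ! (t - 1)\<close> and leaves it
    by \<open>js ! s\<close>; at the base node the leaving index wraps round to 0.\<close>
  define s where "s = (if t = n then 0 else t)"
  have s: "s < n" "ns ! s = a" "s \<noteq> t - 1" using t n2 ends by (auto simp: s_def)
  have only: "r = t - 1 \<or> r = s" if r: "r < n" "js ! r \<in> incs_at G a" for r
  proof -
    consider "a = ns ! r" "r > 0" | "a = ns ! n" "r = 0" | "a = ns ! Suc r"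
      using at[OF r(1)] r(2) ends by (cases r) auto
    then show ?thesis
    proof cases
      case 1
      then have "ns ! r = ns ! t" using t(3) by simp
      then have "r = t" by (rule inj) (use 1(2) r(1) t(1,2) in simp_all)
      then show ?thesis using r by (auto simp: s_def)
    next
      case 2
      then have "ns ! t = ns ! n" using t(3) by simp
      then have "t = n" by (rule inj) (use t(1,2) n2 in simp_all)
      then show ?thesis using 2 by (auto simp: s_def)
    next
      case 3
      then have "ns ! Suc r = ns ! t" using t(3) by simp
      then have "Suc r = t" by (rule inj) (use r(1) t(1,2) in simp_all)
      then show ?thesis by auto
    qed
  qed
  have "set js \<inter> incs_at G a = {js ! (t - 1), js ! s}"
  proof (intro equalityI subsetI)
    fix q assume q: "q \<in> set js \<inter> incs_at G a"
    then obtain r where "r < n" "q = js ! r" by (auto simp: in_set_conv_nth n_def)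
    then show "q \<in> {js ! (t - 1), js ! s}" using only[of r] q by blast
  next
    fix q assume "q \<in> {js ! (t - 1), js ! s}"
    moreover have "js ! (t - 1) \<in> incs_at G a" using at[of "t - 1" a] t by simp
    moreover have "js ! s \<in> incs_at G a" using at[of s a] s by simp
    ultimately show "q \<in> set js \<inter> incs_at G a" using s t by (auto simp: n_def)
  qed
  moreover have "js ! (t - 1) \<noteq> js ! s" using s t dj by (simp add: nth_eq_iff_index_eq n_def)
  ultimately show ?thesis by simp
qed

lemma circle_incs: "circle G ns js \<Longrightarrow> set js \<subseteq> incs G"
  by (auto simp: circle_def walk_def joins_def in_set_conv_nth)

text \<open>Two parallel incidences form the shortest kind of circle. These are the circles of
  \<open>L\<close> to which circles of a subdivision are matched, and in \<open>G\<close> they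
  constrain the signs at \<open>x\<close>.\<close>

lemma circle_two_incs:
  assumes "oriented_hypergraph G" and "i \<in> incs G" and "j \<in> incs G" and "i \<noteq> j"
    and "incf G i = incf G j"
  shows "circle G [Inl (fst (incf G i)), Inr (snd (incf G i)), Inl (fst (incf G i))] [i, j]"
proof -
  have "incf G i \<in> verts G \<times> edges G" using assms by (auto simp: oriented_hypergraph_def)
  then have "fst (incf G i) \<in> verts G" "snd (incf G i) \<in> edges G" by auto
  then show ?thesis using assms
    by (auto simp: circle_def walk_def joins_def less_Suc_eq)
qed

text \<open>The incidence set of a circle has no leaf: it meets each of its nodes in two
  incidences.\<close>

lemma acyclic_off_not_circle:
  assumes "acyclic_off G x" and "circle G ns js"
  shows "set js \<inter> incs_vert G x \<noteq> {}"
proof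
  assume "set js \<inter> incs_vert G x = {}"
  then have "set js \<subseteq> incs G - incs_vert G x" using circle_incs[OF assms(2)] by auto
  moreover have "set js \<noteq> {}" using assms(2) by (auto simp: circle_def)
  ultimately obtain a i where a: "set js \<inter> incs_at G a = {i}"
    using acyclic_offD[OF assms(1)] by blast
  then have "i \<in> set js" "i \<in> incs_at G a" by auto
  then show False using circle_incs_at[OF assms(2)] a by fastforce
qed

section \<open>Invariance of circle signs under switching\<close>

text \<open>An even number of negations cancels in the product. The cases 0 and 2 are those of a
  circle avoiding or visiting the switched node.\<close>

lemma sign_flip:
  assumes "card (set js \<inter> A) \<in> {0, 2}" and "distinct js"
  shows "(\<Prod>i\<leftarrow>js. if i \<in> A then - f i else f i) = (\<Prod>i\<leftarrow>js. f i :: int)"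
proof -
  have "(\<Prod>i\<leftarrow>js. if i \<in> A then - f i else f i) = (\<Prod>i\<in>set js. (if i \<in> A then -1 else 1) * f i)"
    using assms(2) by (subst prod.distinct_set_conv_list [symmetric]) (auto intro: prod.cong)
  also have "\<dots> = (\<Prod>i\<in>set js. if i \<in> A then -1 else 1) * (\<Prod>i\<in>set js. f i)"
    by (rule prod.distrib)
  also have "(\<Prod>i\<in>set js. if i \<in> A then -1 else (1::int)) = (-1) ^ card (set js \<inter> A)"
    by (simp add: prod.If_cases)
  also have "\<dots> = 1" using assms(1) by auto
  finally show ?thesis using assms(2) by (simp add: prod.distinct_set_conv_list)
qed

lemma orient_irrelevant [simp]:
  "incs_vert (G\<lparr>orient := f\<rparr>) v = incs_vert G v"
  "incs_edge (G\<lparr>orient := f\<rparr>) e = incs_edge G e"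
  "incs_at (G\<lparr>orient := f\<rparr>) a = incs_at G a"
  "circle (G\<lparr>orient := f\<rparr>) ns js = circle G ns js"
  "acyclic_off (G\<lparr>orient := f\<rparr>) x = acyclic_off G x"
  by (auto simp: incs_vert_def incs_edge_def incs_at_def circle_def walk_def joins_def acyclic_off_def)

lemma circle_sign_flip:
  assumes "circle G ns js"
  shows "circle_sign (G\<lparr>orient := (\<lambda>i. if i \<in> incs_at G a then - orient G i else orient G i)\<rparr>) js
    = circle_sign G js"
proof -
  have "card (set js \<inter> incs_at G a) \<in> {0, 2}"
    using circle_incs_at[OF assms, of _ a] by (cases "set js \<inter> incs_at G a = {}") auto
  then show ?thesis using sign_flip[of js "incs_at G a" "orient G"] assms
    by (simp add: circle_sign_def circle_def)
qed

lemma switching_equivalent_orient: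
  "switching_equivalent G H \<Longrightarrow> \<exists>f. H = G\<lparr>orient := f\<rparr>"
proof (induction rule: switching_equivalent.induct)
  case (refl G)
  then show ?case by (intro exI[of _ "orient G"]) simp
qed (auto simp: switch_vert_def switch_edge_def)

lemma switching_equivalent_circle:
  assumes "switching_equivalent G H"
  shows "circle H = circle G"
  using switching_equivalent_orient[OF assms] by (auto simp: fun_eq_iff)

lemma switching_equivalent_sign:
  assumes "switching_equivalent G H" and "circle G ns js"
  shows "circle_sign H js = circle_sign G js"
  using assms
proof (induction rule: switching_equivalent.induct)
  case (vert G H v)
  then show ?case
    using circle_sign_flip[of H ns js "Inl v"] switching_equivalent_circle[OF vert(1)]
    by (simp add: switch_vert_def)
next
  case (edge G H e)
  then show ?case
    using circle_sign_flip[of H ns js "Inr e"] switching_equivalent_circle[OF edge(1)]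
    by (simp add: switch_edge_def)
qed simp

text \<open>The edges of \<open>F\<close> are switched one after another; since every incidence lies
  on a single edge, none is negated twice.\<close>

lemma switch_edges:
  assumes "finite F" and "F \<subseteq> edges G"
  shows "switching_equivalent G
    (G\<lparr>orient := (\<lambda>i. if i \<in> incs G \<and> snd (incf G i) \<in> F then - orient G i else orient G i)\<rparr>)"
  using assms
proof (induction F rule: finite_induct)
  case empty
  then show ?case by (simp add: switching_equivalent.refl)
next
  case (insert e F)
  let ?H = "G\<lparr>orient := (\<lambda>i. if i \<in> incs G \<and> snd (incf G i) \<in> F then - orient G i else orient G i)\<rparr>"
  have "switching_equivalent G (switch_edge e ?H)"
    using insert by (intro switching_equivalent.edge) auto
  moreover have "switch_edge e ?H = G\<lparr>orient := (\<lambda>i. if i \<in> incs G \<and> snd (incf G i) \<in> insert e F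
      then - orient G i else orient G i)\<rparr>"
    using insert(2) by (intro ohg.equality) (auto simp: switch_edge_def incs_edge_def)
  ultimately show ?case by simp
qed

section \<open>Subdivisions keep the forest away from the original vertex\<close>

text \<open>If \<open>e\<close> is the unique node meeting \<open>S\<close> in one incidence, then one of \<open>e\<^sub>1\<close>, \<open>e\<^sub>2\<close> does the same
  in the subdivision: which one depends on whether \<open>S\<close> runs through the new vertex.\<close>

lemma subdivides_edge_acyclic_off:
  assumes sub: "subdivides_edge G H" and x: "x \<in> verts G" and ac: "acyclic_off G x"
  shows "x \<in> verts H" "incs_vert H x = incs_vert G x" "acyclic_off H x"
proof -
  obtain e e1 e2 w j1 j2 where e: "e \<in> edges G" "e1 \<noteq> e2" "e1 \<notin> edges G - {e}" "e2 \<notin> edges G - {e}"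
    and w: "w \<notin> verts G" and j: "j1 \<noteq> j2" "j1 \<notin> incs G" "j2 \<notin> incs G"
    and H: "verts H = verts G \<union> {w}" "edges H = (edges G - {e}) \<union> {e1, e2}"
        "incs H = incs G \<union> {j1, j2}"
    and Hw: "incs_vert H w = {j1, j2}"
    and j1: "j1 \<in> incs_edge H e1" and j2: "j2 \<in> incs_edge H e2"
    and dis: "incs_edge H e1 \<inter> incs_edge H e2 = {}"
    and un: "(incs_edge H e1 - {j1}) \<union> (incs_edge H e2 - {j2}) = incs_edge G e"
    and old: "\<forall>i\<in>incs G. orient H i = orient G i \<and> fst (incf H i) = fst (incf G i)"
    and olde: "\<forall>i\<in>incs G - incs_edge G e. snd (incf H i) = snd (incf G i)"
    and oG: "oriented_hypergraph G"
    using sub unfolding subdivides_edge_def by (elim exE conjE) (rule that; assumption)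
  have fstj: "fst (incf H j1) = w" "fst (incf H j2) = w"
    using Hw by (auto simp: incs_vert_def)
  have sndj: "snd (incf H j1) = e1" "snd (incf H j2) = e2"
    using j1 j2 by (auto simp: incs_edge_def)
  have vert: "incs_vert H u = incs_vert G u" if "u \<noteq> w" for u
    using that old fstj H by (auto simp: incs_vert_def)
  show "x \<in> verts H" using H x by auto
  show vx: "incs_vert H x = incs_vert G x" by (rule vert) (use w x in blast)
  have range: "i \<in> incs G \<Longrightarrow> snd (incf G i) \<in> edges G" for i
    using oG by (auto simp: oriented_hypergraph_def mem_Times_iff)
  \<comment> \<open>An old incidence can only move from \<open>e\<close> to \<open>e1\<close> or
    \<open>e2\<close>, and these names differ from every other edge \<open>f\<close> of
    \<open>G\<close>.\<close>
  have edge: "incs_edge H f \<inter> incs G = incs_edge G f"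
    if "f \<noteq> e" "f \<in> edges G" for f
  proof -
    have f: "f \<noteq> e1" "f \<noteq> e2" using that e by auto
    have "i \<in> incs_edge H f \<longleftrightarrow> i \<in> incs_edge G f" if "i \<in> incs G" for i
    proof (cases "i \<in> incs_edge G e")
      case True
      then have "snd (incf H i) \<in> {e1, e2}" using un by (auto simp: incs_edge_def)
      then show ?thesis using f True \<open>f \<noteq> e\<close> by (auto simp: incs_edge_def)
    next
      case False
      then show ?thesis using olde that H by (auto simp: incs_edge_def)
    qed
    then show ?thesis by (auto simp: incs_edge_def)
  qed
  show "acyclic_off H x"
    unfolding acyclic_off_def
  proof (intro allI impI)
    fix S assume S: "S \<subseteq> incs H - incs_vert H x" and ne: "S \<noteq> {}"
    \<comment> \<open>\<open>T\<close> is the part of \<open>S\<close> that already lives in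
      \<open>G\<close>, where a leaf is available by hypothesis.\<close>
    define T where "T = S \<inter> incs G"
    have e1: "S \<inter> incs_edge H e1 - {j1} = T \<inter> incs_edge H e1"
      using H(3) j sndj e(2) S by (auto simp: T_def incs_edge_def)
    have e2: "S \<inter> incs_edge H e2 - {j2} = T \<inter> incs_edge H e2"
      using H(3) j sndj e(2) S by (auto simp: T_def incs_edge_def)
    have Te: "T \<inter> incs_edge G e = (T \<inter> incs_edge H e1) \<union> (T \<inter> incs_edge H e2)"
      using un j by (auto simp: T_def)
    have Sw: "S \<inter> incs_at H (Inl w) = S \<inter> {j1, j2}" using Hw by simp
    \<comment> \<open>If \<open>S\<close> contains exactly one of the new incidences, then
      \<open>w\<close> is a leaf; if it consists of just these two, then \<open>e1\<close> is one.
      In the remaining case a leaf of \<open>T\<close> in \<open>G\<close> is carried over to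
      \<open>H\<close>.\<close>
    consider "j1 \<in> S" "j2 \<notin> S" | "j1 \<notin> S" "j2 \<in> S" | "j1 \<in> S" "j2 \<in> S" "T = {}"
      | "j1 \<in> S \<longleftrightarrow> j2 \<in> S" "T \<noteq> {}"
      using ne S H(3) by (auto simp: T_def)
    then show "\<exists>a i. S \<inter> incs_at H a = {i}"
    proof cases
      case 1
      then show ?thesis using Sw by (intro exI[of _ "Inl w"] exI[of _ j1]) auto
    next
      case 2
      then show ?thesis using Sw by (intro exI[of _ "Inl w"] exI[of _ j2]) auto
    next
      case 3
      then have "S \<inter> incs_at H (Inr e1) = {j1}" using e1 j1 by auto
      then show ?thesis by blast
    next
      case 4
      have "T \<subseteq> incs G - incs_vert G x" using S vx by (auto simp: T_def)
      then obtain a i where a: "T \<inter> incs_at G a = {i}"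
        using acyclic_offD[OF ac _ 4(2)] by blast
      show ?thesis
      proof (cases a)
        case (Inl u)
        have "i \<in> incs_vert G u" using a Inl by auto
        then have "u \<noteq> w" using w oG by (auto simp: incs_vert_def oriented_hypergraph_def mem_Times_iff)
        then have "S \<inter> incs_at H a = {i}" using a Inl vert[of u] by (auto simp: T_def incs_vert_def)
        then show ?thesis by blast
      next
        case (Inr f)
        have i: "i \<in> incs_edge G f" "i \<in> T" using a Inr by auto
        then have f: "f \<in> edges G" using range by (auto simp: incs_edge_def)
        show ?thesis
        proof (cases "f = e")
          case False
          have "S \<inter> incs_edge H f = T \<inter> incs_edge H f"
            using False f e(3,4) sndj H(3) S by (auto simp: T_def incs_edge_def)
          then have "S \<inter> incs_at H a = {i}"
            using a Inr edge[OF False f] by (auto simp: T_def)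
          then show ?thesis by blast
        next
          case True
          then have u: "(T \<inter> incs_edge H e1) \<union> (T \<inter> incs_edge H e2) = {i}" using a Inr Te by simp
          consider "T \<inter> incs_edge H e1 = {i}" "T \<inter> incs_edge H e2 = {}"
            | "T \<inter> incs_edge H e2 = {i}" "T \<inter> incs_edge H e1 = {}"
          proof -
            have "\<not> (T \<inter> incs_edge H e1 = {i} \<and> T \<inter> incs_edge H e2 = {i})"
              using dis by (metis IntE IntI empty_iff singletonI)
            then show ?thesis using u that unfolding Un_singleton_iff by metis
          qed
          then have "\<exists>b l. S \<inter> incs_edge H b = {l}"
          proof cases
            case 1
            then have "S \<inter> incs_edge H e2 = {j2}" if "j2 \<in> S" using that e2 j2 by auto
            moreover have "S \<inter> incs_edge H e1 = {i}" if "j1 \<notin> S" using that e1 1 by auto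
            ultimately show ?thesis using 4 by blast
          next
            case 2
            then have "S \<inter> incs_edge H e1 = {j1}" if "j1 \<in> S" using that e1 j1 by auto
            moreover have "S \<inter> incs_edge H e2 = {i}" if "j2 \<notin> S" using that e2 2 by auto
            ultimately show ?thesis using 4 by blast
          qed
          then show ?thesis by (metis incs_at_simps(2))
        qed
      qed
    qed
  qed
qed

lemma subdivision_acyclic_off:
  assumes "subdivision G H" and "x \<in> verts G" and "acyclic_off G x"
  shows "x \<in> verts H \<and> incs_vert H x = incs_vert G x \<and> acyclic_off H x"
  using assms(1) unfolding subdivision_def
proof (induction rule: rtranclp_induct)
  case (step H K)
  then show ?case using subdivides_edge_acyclic_off[of H K x] by simp
qed (use assms in auto)

text \<open>Every incidence is at \<open>x\<close>, so \<open>acyclic_off\<close> holds vacuously;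
  this is the base of the induction along subdivisions.\<close>

lemma is_L_E:
  assumes "is_L k L"
  obtains x y where "verts L = {x}" "edges L = {y}" "\<And>i. i \<in> incs L \<Longrightarrow> incf L i = (x, y)"
    "incs_vert L x = incs L" "acyclic_off L x" "oriented_hypergraph L"
proof -
  obtain x y where xy: "verts L = {x}" "edges L = {y}"
    using assms by (auto simp: is_L_def card_1_singleton_iff)
  have o: "oriented_hypergraph L" using assms by (simp add: is_L_def)
  then have f: "incf L i = (x, y)" if "i \<in> incs L" for i
    using that xy by (auto simp: oriented_hypergraph_def)
  then have "incs_vert L x = incs L" by (auto simp: incs_vert_def)
  then show ?thesis using that[of x y] xy f o by (auto simp: acyclic_off_def)
qed

text \<open>The incidences at \<open>x\<close> stay those of \<open>L\<close> under subdivision. A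
  circle must visit \<open>x\<close>, the rest being a forest, and so uses two of them, which are
  parallel in \<open>L\<close>.\<close>

lemma subdivision_L_circle:
  assumes L: "is_L k L" and sub: "subdivision L H" and c: "circle H ns js"
  shows "\<exists>ns' i j. circle L ns' [i, j] \<and> {i, j} = set js \<inter> incs L \<and> i \<in> incs L \<and> j \<in> incs L"
proof -
  obtain x y where xy: "verts L = {x}" "edges L = {y}" "\<And>i. i \<in> incs L \<Longrightarrow> incf L i = (x, y)"
    "incs_vert L x = incs L" "acyclic_off L x" "oriented_hypergraph L"
    using is_L_E[OF L] by metis
  have H: "incs_vert H x = incs L" "acyclic_off H x"
    using subdivision_acyclic_off[OF sub, of x] xy by auto
  then obtain l where "l \<in> set js" "l \<in> incs_at H (Inl x)"
    using acyclic_off_not_circle[OF H(2) c] by auto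
  then have "card (set js \<inter> incs L) = 2" using circle_incs_at[OF c] H by fastforce
  then obtain i j where ij: "set js \<inter> incs L = {i, j}" "i \<noteq> j" by (auto simp: card_2_iff)
  then have "i \<in> incs L" "j \<in> incs L" by auto
  then show ?thesis using circle_two_incs[of L i j] xy ij by metis
qed

section \<open>Degree sums and contraction to a single vertex and edge\<close>

text \<open>Comparing this degree sum with the one over edges later shows that a minimal cross-theta
  has as many edges as vertices.\<close>

lemma incs_vert_card_sum:
  assumes "oriented_hypergraph G"
  shows "card (incs G) = (\<Sum>v\<in>verts G. card (incs_vert G v))"
proof -
  have "incs G = (\<Union>v\<in>verts G. incs_vert G v)"
    using assms by (auto simp: oriented_hypergraph_def incs_vert_def mem_Times_iff)
  moreover have "card (\<Union>v\<in>verts G. incs_vert G v) = (\<Sum>v\<in>verts G. card (incs_vert G v))"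
    using assms by (intro card_UN_disjoint) (auto simp: oriented_hypergraph_def incs_vert_def)
  ultimately show ?thesis by simp
qed

lemma incs_edge_card_sum:
  assumes "oriented_hypergraph G"
  shows "card (incs G) = (\<Sum>e\<in>edges G. card (incs_edge G e))"
proof -
  have "incs G = (\<Union>e\<in>edges G. incs_edge G e)"
    using assms by (auto simp: oriented_hypergraph_def incs_edge_def mem_Times_iff)
  moreover have "card (\<Union>e\<in>edges G. incs_edge G e) = (\<Sum>e\<in>edges G. card (incs_edge G e))"
    using assms by (intro card_UN_disjoint) (auto simp: oriented_hypergraph_def incs_edge_def)
  ultimately show ?thesis by simp
qed

text \<open>If the leaf of \<open>S\<close> is one of the two merged edges, then a leaf of \<open>S \<union> {j1, j2}\<close> either
  survives the contraction or shows that \<open>S\<close> avoids the other merged edge.\<close>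

lemma contract_vertex:
  assumes oG: "oriented_hypergraph G" and w: "w \<in> verts G" "w \<noteq> x"
    and Iw: "incs_vert G w = {j1, j2}" "j1 \<noteq> j2" and ac: "acyclic_off G x"
  shows "\<exists>K. oriented_hypergraph K \<and> subdivides_edge K G \<and> acyclic_off K x \<and>
    verts K = verts G - {w} \<and> card (edges K) = card (edges G) - 1 \<and> orient K = orient G \<and>
    (\<forall>u. u \<noteq> w \<longrightarrow> incs_vert K u = incs_vert G u)"
proof -
  define e1 where "e1 = snd (incf G j1)"
  define e2 where "e2 = snd (incf G j2)"
  have j: "j1 \<in> incs G" "j2 \<in> incs G" "fst (incf G j1) = w" "fst (incf G j2) = w"
    using Iw by (auto simp: incs_vert_def)
  have only: "fst (incf G i) \<noteq> w" if "i \<in> incs G - {j1, j2}" for i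
    using that Iw by (auto simp: incs_vert_def)
  have fin: "finite (verts G)" "finite (edges G)" "finite (incs G)"
    and rng: "\<And>i. i \<in> incs G \<Longrightarrow> fst (incf G i) \<in> verts G" "\<And>i. i \<in> incs G \<Longrightarrow> snd (incf G i) \<in> edges G"
    and ori: "\<And>i. i \<in> incs G \<Longrightarrow> orient G i = 1 \<or> orient G i = -1"
    using oG by (auto simp: oriented_hypergraph_def mem_Times_iff)
  have ee: "e1 \<in> edges G" "e2 \<in> edges G" using j rng by (auto simp: e1_def e2_def)
  have J: "{j1, j2} \<subseteq> incs G - incs_vert G x" using j w by (auto simp: incs_vert_def)
  \<comment> \<open>If both incidences at \<open>w\<close> had the same edge, every node would meet
    both or neither of them, so the pair would have no leaf.\<close>
  have "e1 \<noteq> e2"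
  proof
    assume eq: "e1 = e2"
    obtain a i where a: "{j1, j2} \<inter> incs_at G a = {i}"
      using acyclic_offD[OF ac J] by blast
    have "j1 \<in> incs_at G a \<longleftrightarrow> j2 \<in> incs_at G a"
      using eq j by (auto simp: incs_at_def e1_def e2_def)
    then have "card ({j1, j2} \<inter> incs_at G a) \<noteq> 1"
      using Iw(2) by (cases "j1 \<in> incs_at G a") simp_all
    then show False using a by simp
  qed
  \<comment> \<open>The merged edge keeps the name \<open>e2\<close>, which is then the edge that is
    subdivided to get \<open>G\<close> back. The function \<open>orient\<close> is carried over
    whole, so that orientations can be compared as functions.\<close>
  define K where "K = \<lparr>verts = verts G - {w}, edges = edges G - {e1}, incs = incs G - {j1, j2},
    incf = (\<lambda>i. (fst (incf G i), if snd (incf G i) = e1 then e2 else snd (incf G i))),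
    orient = orient G\<rparr>"
  have K: "verts K = verts G - {w}" "edges K = edges G - {e1}" "incs K = incs G - {j1, j2}"
      "orient K = orient G" "\<And>i. fst (incf K i) = fst (incf G i)"
      "\<And>i. snd (incf K i) = (if snd (incf G i) = e1 then e2 else snd (incf G i))"
    by (simp_all add: K_def)
  have oK: "oriented_hypergraph K"
    unfolding oriented_hypergraph_def
    using fin rng ori only ee \<open>e1 \<noteq> e2\<close> by (auto simp: K mem_Times_iff)
  have vert: "incs_vert K u = incs_vert G u" if "u \<noteq> w" for u
    using that j by (auto simp: incs_vert_def K)
  have edge: "incs_edge K f = incs_edge G f" if "f \<noteq> e1" "f \<noteq> e2" for f
    using that by (auto simp: incs_edge_def K e1_def e2_def)
  have edge2: "incs_edge K e2 = (incs_edge G e1 - {j1}) \<union> (incs_edge G e2 - {j2})"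
    using \<open>e1 \<noteq> e2\<close> by (auto simp: incs_edge_def K e1_def e2_def)
  have dis: "incs_edge G e1 \<inter> incs_edge G e2 = {}"
    using \<open>e1 \<noteq> e2\<close> by (auto simp: incs_edge_def)
  have j1: "j1 \<in> incs_edge G e1" and j2: "j2 \<in> incs_edge G e2"
    using j by (auto simp: incs_edge_def e1_def e2_def)
  have sub: "subdivides_edge K G"
    unfolding subdivides_edge_def
  proof (intro conjI oK oG exI)
    show "e2 \<in> edges K" "e1 \<notin> edges K - {e2}" "e2 \<notin> edges K - {e2}" "w \<notin> verts K"
        "j1 \<notin> incs K" "j2 \<notin> incs K" "verts G = verts K \<union> {w}"
        "edges G = (edges K - {e2}) \<union> {e1, e2}" "incs G = incs K \<union> {j1, j2}"
      using ee w j \<open>e1 \<noteq> e2\<close> by (auto simp: K)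
    show "\<forall>i\<in>incs K. orient G i = orient K i \<and> fst (incf G i) = fst (incf K i)"
      by (simp add: K)
    show "\<forall>i\<in>incs K - incs_edge K e2. snd (incf G i) = snd (incf K i)"
      by (auto simp: K incs_edge_def)
  qed (use \<open>e1 \<noteq> e2\<close> Iw j1 j2 dis edge2 in simp_all)
  have "acyclic_off K x"
    unfolding acyclic_off_def
  proof (intro allI impI)
    fix S assume S: "S \<subseteq> incs K - incs_vert K x" and ne: "S \<noteq> {}"
    have nj: "j1 \<notin> S" "j2 \<notin> S" using S K by auto
    have SG: "S \<subseteq> incs G - incs_vert G x" using S vert[of x] w by (auto simp: K)
    \<comment> \<open>Adding the passage through \<open>w\<close> probes both merged edges at once.
      Its leaf \<open>b\<close> cannot be \<open>w\<close>, which meets both added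
      incidences.\<close>
    define T where "T = S \<union> {j1, j2}"
    have Tn: "T \<subseteq> incs G - incs_vert G x" "T \<noteq> {}" using SG J by (auto simp: T_def)
    obtain a i where a: "S \<inter> incs_at G a = {i}" using acyclic_offD[OF ac SG ne] by blast
    obtain b l where b: "T \<inter> incs_at G b = {l}" using acyclic_offD[OF ac Tn] by blast
    have S2: "S \<inter> incs_edge K e2 = (S \<inter> incs_edge G e1) \<union> (S \<inter> incs_edge G e2)"
      using nj edge2 by auto
    \<comment> \<open>The node \<open>w\<close> is no leaf of \<open>S\<close>, as \<open>S\<close>
      avoids its incidences; all nodes other than \<open>w\<close> and the two merged edges keep
      their incidences in \<open>K\<close>.\<close>
    have keep: "\<exists>a i. S \<inter> incs_at K a = {i}" if "S \<inter> incs_at G c = {m}" "c \<noteq> Inr e1" "c \<noteq> Inr e2" for c m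
    proof (cases c)
      case (Inl u)
      have "u \<noteq> w"
      proof
        assume "u = w"
        then have "S \<inter> {j1, j2} = {m}" using that(1) Inl Iw by simp
        then show False using nj by auto
      qed
      then have "S \<inter> incs_at K c = {m}" using that Inl vert by simp
      then show ?thesis by blast
    next
      case (Inr f)
      then have "S \<inter> incs_at K c = {m}" using that edge by simp
      then show ?thesis by blast
    qed
    show "\<exists>a i. S \<inter> incs_at K a = {i}"
    proof (cases "a = Inr e1 \<or> a = Inr e2")
      case False
      then show ?thesis using keep a by blast
    next
      case True
      have "T \<inter> incs_at G (Inl w) = {j1, j2}" using Iw by (auto simp: T_def)
      then have bw: "b \<noteq> Inl w" using b Iw(2) by auto
      show ?thesis
      proof (cases "b = Inr e1 \<or> b = Inr e2")
        case False
        have "j1 \<notin> incs_at G b" "j2 \<notin> incs_at G b"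
          using False bw j by (auto simp: incs_at_def e1_def e2_def)
        then have "S \<inter> incs_at G b = {l}" using b by (auto simp: T_def)
        then show ?thesis using keep False by blast
      next
        case bTrue: True
        have emp: "S \<inter> incs_at G b = {}"
        proof -
          have "\<exists>q\<in>{j1, j2}. q \<in> incs_at G b" using bTrue j1 j2 by auto
          then obtain q where q: "q \<in> {j1, j2}" "q \<in> incs_at G b" by blast
          then have "q \<in> T \<inter> incs_at G b" by (auto simp: T_def)
          then have "q = l" unfolding b by simp
          moreover have "S \<inter> incs_at G b \<subseteq> {l}" unfolding b[symmetric] by (auto simp: T_def)
          ultimately show ?thesis using q(1) nj by blast
        qed
        then have "a \<noteq> b" using a by auto
        then have "S \<inter> incs_edge K e2 = {i}"
          using S2 True bTrue a emp by auto
        then show ?thesis by (metis incs_at_simps(2))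
      qed
    qed
  qed
  moreover have "card (edges K) = card (edges G) - 1" using ee fin by (simp add: K)
  ultimately show ?thesis using oK sub K(1,4) vert by blast
qed

text \<open>Induction on the number of vertices. Contracting a vertex other than \<open>x\<close>
  removes one vertex and one edge and preserves the other degrees; once only \<open>x\<close> is
  left, the equal counts leave exactly one edge.\<close>

lemma tree_off_subdivision:
  assumes "oriented_hypergraph G" and "x \<in> verts G"
    and "\<And>v. v \<in> verts G \<Longrightarrow> v \<noteq> x \<Longrightarrow> card (incs_vert G v) = 2"
    and "acyclic_off G x" and "card (edges G) = card (verts G)"
  shows "\<exists>L. is_L (card (incs_vert G x)) L \<and> incs L = incs_vert G x \<and> orient L = orient G \<and>
    subdivision L G"
  using assms
proof (induction "card (verts G)" arbitrary: G rule: less_induct)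
  case less
  have fin: "finite (verts G)" using less.prems(1) by (simp add: oriented_hypergraph_def)
  show ?case
  proof (cases "verts G = {x}")
    case True
    then have "incs_vert G x = incs G"
      using less.prems(1) by (auto simp: incs_vert_def oriented_hypergraph_def mem_Times_iff)
    then show ?thesis using True less.prems
      by (intro exI[of _ G]) (auto simp: is_L_def subdivision_def)
  next
    case False
    then obtain w where w: "w \<in> verts G" "w \<noteq> x" using less.prems(2) by auto
    then obtain j1 j2 where "incs_vert G w = {j1, j2}" "j1 \<noteq> j2"
      using less.prems(3)[OF w] by (auto simp: card_2_iff)
    from contract_vertex[OF less.prems(1) w this less.prems(4)]
    obtain K where K: "oriented_hypergraph K" "subdivides_edge K G" "acyclic_off K x"
      "verts K = verts G - {w}" "card (edges K) = card (edges G) - 1" "orient K = orient G"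
      "\<And>u. u \<noteq> w \<Longrightarrow> incs_vert K u = incs_vert G u" by blast
    have "card (verts K) < card (verts G)" unfolding K(4) using fin w(1) by (rule card_Diff1_less)
    moreover have "card (edges K) = card (verts K)" using K(4,5) fin w less.prems(5) by simp
    moreover have "x \<in> verts K" using K(4) w less.prems(2) by simp
    moreover have "card (incs_vert K v) = 2" if "v \<in> verts K" "v \<noteq> x" for v
      using that K(4) K(7)[of v] less.prems(3)[of v] by simp
    ultimately obtain L where L: "is_L (card (incs_vert K x)) L" "incs L = incs_vert K x"
        "orient L = orient K" "subdivision L K"
      using less.hyps[of K] K(1,3) by blast
    have "subdivision L G"
      using L(4) K(2) unfolding subdivision_def by (rule rtranclp.rtrancl_into_rtrancl)
    then show ?thesis using L K(6) K(7)[of x] w by auto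
  qed
qed

section \<open>Degrees and forest structure of a minimal cross-theta\<close>

text \<open>The vertex \<open>x\<close> is the common end of the paths. Away from \<open>x\<close>,
  the paths form a tree of arms joined at the common end edge.\<close>

lemma minimal_cross_theta_tree_off:
  assumes "minimal_cross_theta k G"
  obtains x where "x \<in> verts G" "card (incs_vert G x) = k" "acyclic_off G x"
    "\<And>v. v \<in> verts G \<Longrightarrow> v \<noteq> x \<Longrightarrow> card (incs_vert G v) = 2" "card (edges G) = card (verts G)"
proof -
  obtain P where oG: "oriented_hypergraph G" and ct: "cross_theta_paths G k P"
    and nodes: "Inl ` verts G \<union> Inr ` edges G = (\<Union>p<k. set (fst (P p)))"
    and incs: "incs G = (\<Union>p<k. set (snd (P p)))"
    using assms by (auto simp: minimal_cross_theta_def)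
  define N where "N p = fst (P p)" for p
  define J where "J p = snd (P p)" for p
  define n where "n p = length (J p)" for p
  from ct obtain x y where x: "x \<in> verts G" and y: "y \<in> edges G"
    and P': "\<forall>p<k. path G (fst (P p)) (snd (P p)) \<and> odd (length (snd (P p))) \<and>
        hd (fst (P p)) = Inl x \<and> last (fst (P p)) = Inr y"
    unfolding cross_theta_paths_def by (elim conjE bexE) (rule that)
  have P: "\<And>p. p < k \<Longrightarrow> path G (N p) (J p) \<and> odd (length (J p)) \<and>
        hd (N p) = Inl x \<and> last (N p) = Inr y"
    using P' by (simp add: N_def J_def)
  have disj: "\<And>p q. p < k \<Longrightarrow> q < k \<Longrightarrow> p \<noteq> q \<Longrightarrow>
        set (butlast (tl (N p))) \<inter> set (butlast (tl (N q))) = {} \<and> set (J p) \<inter> set (J q) = {}"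
    using ct by (simp add: cross_theta_paths_def N_def J_def)
  have len: "length (N p) = Suc (n p)" "distinct (N p)" "distinct (J p)" if "p < k" for p
    using P[OF that] by (auto simp: path_def walk_def n_def)
  have jn: "joins G (N p ! m) (J p ! m) (N p ! Suc m)" if "p < k" "m < n p" for p m
    using P[OF that(1)] that(2) by (auto simp: path_def walk_def n_def)
  have N0: "N p ! 0 = Inl x" and Nn: "N p ! n p = Inr y" and npos: "0 < n p" if "p < k" for p
  proof -
    have ne: "N p \<noteq> []" using len(1)[OF that] by auto
    show "N p ! 0 = Inl x" using P[OF that] ne by (simp add: hd_conv_nth)
    show "N p ! n p = Inr y" using P[OF that] ne len(1)[OF that] by (simp add: last_conv_nth)
    show "0 < n p" using P[OF that] by (auto simp: n_def intro: Nat.gr0I)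
  qed
  have inN: "s = t" if "p < k" "s \<le> n p" "t \<le> n p" "N p ! s = N p ! t" for p s t
    using that len[OF that(1)] by (simp add: nth_eq_iff_index_eq)
  have int: "N p ! m \<in> set (butlast (tl (N p)))" if "p < k" "0 < m" "m < n p" for p m
  proof -
    have "butlast (tl (N p)) ! (m - 1) = N p ! m"
      using that len(1)[OF that(1)] by (simp add: nth_butlast nth_tl)
    moreover have "m - 1 < length (butlast (tl (N p)))" using that len(1)[OF that(1)] by simp
    ultimately show ?thesis by (metis nth_mem)
  qed
  \<comment> \<open>An interior node occurs at one place among all paths: it is neither common end,
    and interiors of different paths are disjoint.\<close>
  have Neq: "p = q \<and> s = t"
    if "p < k" "q < k" "0 < s" "s < n p" "t \<le> n q" "N p ! s = N q ! t" for p q s t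
  proof -
    have nx: "N p ! s \<noteq> Inl x" using N0[OF that(1)] inN[OF that(1), of s 0] that by auto
    have ny: "N p ! s \<noteq> Inr y" using Nn[OF that(1)] inN[OF that(1), of s "n p"] that by auto
    have t: "0 < t" "t < n q"
      using nx ny N0[OF that(2)] Nn[OF that(2)] that by (auto intro: Nat.gr0I le_neq_implies_less)
    have "p = q"
    proof (rule ccontr)
      assume "p \<noteq> q"
      then show False using disj[OF that(1,2)] int[OF that(1,3,4)] int[OF that(2) t] that(6) by auto
    qed
    then show ?thesis using inN[OF that(1), of s t] that by auto
  qed
  have Jeq: "p = q \<and> s = t"
    if "p < k" "q < k" "s < n p" "t < n q" "J p ! s = J q ! t" for p q s t
  proof -
    have "J p ! s \<in> set (J p)" "J q ! t \<in> set (J q)" using that(3,4) by (auto simp: n_def)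
    then have "p = q" using disj[OF that(1,2)] that(5) by auto
    then show ?thesis using that len(3)[OF that(1)] by (simp add: nth_eq_iff_index_eq n_def)
  qed
  have at: "J p ! m \<in> incs_at G a \<longleftrightarrow> a = N p ! m \<or> a = N p ! Suc m" if "p < k" "m < n p" for p m a
    using joins_ends(2)[OF jn[OF that]] .
  have incE: "\<exists>p<k. \<exists>m<n p. i = J p ! m" if "i \<in> incs G" for i
    using that incs by (auto simp: J_def n_def in_set_conv_nth)
  have at_sub: "incs_at G a \<subseteq> incs G" for a by (auto simp: incs_at_def)
  have at_int: "incs_at G (N p ! m) = {J p ! (m - 1), J p ! m}" "card (incs_at G (N p ! m)) = 2"
    if p: "p < k" "0 < m" "m < n p" for p m
  proof -
    show 1: "incs_at G (N p ! m) = {J p ! (m - 1), J p ! m}"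
    proof (intro equalityI subsetI)
      fix i assume i: "i \<in> incs_at G (N p ! m)"
      then obtain q l where q: "q < k" "l < n q" "i = J q ! l" using incE at_sub by blast
      then have "N p ! m = N q ! l \<or> N p ! m = N q ! Suc l" using at[of q l] i by auto
      then have "p = q \<and> (m = l \<or> m = Suc l)"
        using Neq[OF p(1) q(1) p(2,3)] q(2) by (metis Suc_leI less_imp_le)
      then show "i \<in> {J p ! (m - 1), J p ! m}" using q(3) by auto
    qed (use at[of p m] at[of p "m - 1"] p in auto)
    have "J p ! (m - 1) \<noteq> J p ! m" using Jeq[OF p(1) p(1), of "m - 1" m] p by linarith
    then show "card (incs_at G (N p ! m)) = 2" using 1 by simp
  qed
  have at_x: "incs_at G (Inl x) = (\<lambda>p. J p ! 0) ` {..<k}"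
  proof (intro equalityI subsetI)
    fix i assume i: "i \<in> incs_at G (Inl x)"
    then obtain q l where q: "q < k" "l < n q" "i = J q ! l" using incE at_sub by blast
    then have "N q ! 0 = N q ! l \<or> N q ! 0 = N q ! Suc l"
      using at[OF q(1,2), of "Inl x"] i N0[OF q(1)] by simp
    then have "l = 0" using inN[OF q(1), of 0 l] inN[OF q(1), of 0 "Suc l"] q(2) by fastforce
    then show "i \<in> (\<lambda>p. J p ! 0) ` {..<k}" using q by auto
  next
    fix i assume "i \<in> (\<lambda>p. J p ! 0) ` {..<k}"
    then obtain p where "p < k" "i = J p ! 0" by blast
    then show "i \<in> incs_at G (Inl x)" using at[of p 0 "Inl x"] N0[of p] npos[of p] by simp
  qed
  \<comment> \<open>The first incidences are distinct even for paths with a single incidence, since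
    the incidence sets of different paths are disjoint.\<close>
  have "card (incs_at G (Inl x)) = k"
    unfolding at_x by (subst card_image) (auto intro!: inj_onI dest: Jeq[OF _ _ npos npos])
  then have card_x: "card (incs_vert G x) = k" by simp
  have at_y: "incs_at G (Inr y) = (\<lambda>p. J p ! (n p - 1)) ` {..<k}"
  proof (intro equalityI subsetI)
    fix i assume i: "i \<in> incs_at G (Inr y)"
    then obtain q l where q: "q < k" "l < n q" "i = J q ! l" using incE at_sub by blast
    then have "N q ! n q = N q ! l \<or> N q ! n q = N q ! Suc l"
      using at[OF q(1,2), of "Inr y"] i Nn[OF q(1)] by simp
    then have "n q = Suc l"
      using inN[OF q(1), of "n q" l] inN[OF q(1), of "n q" "Suc l"] q(2) by fastforce
    then have "i = J q ! (n q - 1)" using q(3) by simp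
    then show "i \<in> (\<lambda>p. J p ! (n p - 1)) ` {..<k}" using q(1) by blast
  next
    fix i assume "i \<in> (\<lambda>p. J p ! (n p - 1)) ` {..<k}"
    then obtain p where "p < k" "i = J p ! (n p - 1)" by blast
    then show "i \<in> incs_at G (Inr y)" using at[of p "n p - 1" "Inr y"] Nn[of p] npos[of p] by simp
  qed
  have "card (incs_at G (Inr y)) = k"
  proof -
    have "inj_on (\<lambda>p. J p ! (n p - 1)) {..<k}"
    proof (rule inj_onI)
      fix p q assume pq: "p \<in> {..<k}" "q \<in> {..<k}" "J p ! (n p - 1) = J q ! (n q - 1)"
      then show "p = q" using Jeq[of p q "n p - 1" "n q - 1"] npos[of p] npos[of q] by simp
    qed
    then show ?thesis unfolding at_y by (simp add: card_image)
  qed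
  then have card_y: "card (incs_edge G y) = k" by simp
  have node: "\<exists>p<k. \<exists>m. 0 < m \<and> m < n p \<and> a = N p ! m"
    if "a \<in> Inl ` verts G \<union> Inr ` edges G" "a \<noteq> Inl x" "a \<noteq> Inr y" for a
  proof -
    have "a \<in> (\<Union>p<k. set (N p))" using that(1) unfolding nodes N_def .
    then obtain p where p: "p < k" "a \<in> set (N p)" by blast
    then obtain m where m: "m \<le> n p" "a = N p ! m"
      using len(1) by (auto simp: in_set_conv_nth less_Suc_eq_le)
    have "m \<noteq> 0" "m \<noteq> n p" using m(2) that(2,3) N0[OF p(1)] Nn[OF p(1)] by metis+
    then have "0 < m" "m < n p" using m(1) by auto
    then show ?thesis using p(1) m(2) by blast
  qed
  have deg_v: "card (incs_vert G v) = 2" if "v \<in> verts G" "v \<noteq> x" for v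
  proof -
    obtain p m where "p < k" "0 < m" "m < n p" "Inl v = N p ! m"
      using node[of "Inl v"] \<open>v \<in> verts G\<close> \<open>v \<noteq> x\<close> by auto
    then show ?thesis using at_int(2)[of p m] by (metis incs_at_simps(1))
  qed
  have deg_e: "card (incs_edge G e) = 2" if "e \<in> edges G" "e \<noteq> y" for e
  proof -
    obtain p m where "p < k" "0 < m" "m < n p" "Inr e = N p ! m"
      using node[of "Inr e"] \<open>e \<in> edges G\<close> \<open>e \<noteq> y\<close> by auto
    then show ?thesis using at_int(2)[of p m] by (metis incs_at_simps(2))
  qed
  have fin: "finite (verts G)" "finite (edges G)" using oG by (auto simp: oriented_hypergraph_def)
  \<comment> \<open>Interior nodes have degree 2 and the two ends have degree \<open>k\<close>, so
    both degree sums have the same form and force equal numbers of vertices and edges.\<close>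
  have "card (incs G) = k + 2 * (card (verts G) - 1)"
    using incs_vert_card_sum[OF oG] sum.remove[OF fin(1) x, of "\<lambda>v. card (incs_vert G v)"]
      card_x deg_v fin x by simp
  moreover have "card (incs G) = k + 2 * (card (edges G) - 1)"
    using incs_edge_card_sum[OF oG] sum.remove[OF fin(2) y, of "\<lambda>e. card (incs_edge G e)"]
      card_y deg_e fin y by simp
  moreover have "card (verts G) > 0" "card (edges G) > 0" using fin x y by (auto simp: card_gt_0_iff)
  ultimately have card_eq: "card (edges G) = card (verts G)" by simp
  have ac: "acyclic_off G x"
    unfolding acyclic_off_def
  proof (intro allI impI)
    fix S assume S: "S \<subseteq> incs G - incs_vert G x" and "S \<noteq> {}"
    then obtain p m0 where p: "p < k" "m0 < n p \<and> J p ! m0 \<in> S" using incE by blast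
    \<comment> \<open>The leaf is found where \<open>S\<close> first occurs on a path. As
      \<open>S\<close> avoids \<open>x\<close>, this is not the initial incidence, so its starting
      node is interior, and the preceding incidence there is not in \<open>S\<close>.\<close>
    define m where "m = (LEAST m. m < n p \<and> J p ! m \<in> S)"
    have m: "m < n p" "J p ! m \<in> S" using LeastI[where P = "\<lambda>m. m < n p \<and> J p ! m \<in> S", OF p(2)]
      by (auto simp: m_def)
    have "J p ! 0 \<notin> S" using S at_x p(1) by auto
    then have "m > 0" using m(2) by (auto intro: Nat.gr0I)
    then have "J p ! (m - 1) \<notin> S"
      using not_less_Least[of "m - 1" "\<lambda>m. m < n p \<and> J p ! m \<in> S"] m by (auto simp: m_def[symmetric])
    then have "S \<inter> incs_at G (N p ! m) = {J p ! m}"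
      using at_int(1)[OF p(1) \<open>m > 0\<close> m(1)] m(2) by auto
    then show "\<exists>a i. S \<inter> incs_at G a = {i}" by blast
  qed
  show thesis using that[OF x card_x ac deg_v card_eq] .
qed

section \<open>Negative circles and subdivisions of uniformly signed hypergraphs\<close>

theorem corollary4p1p2:
  fixes k :: nat and G :: "('v, 'e, 'i) ohg"
  assumes "k \<ge> 3" and "minimal_cross_theta k G"
  shows "(\<forall>ns js. circle G ns js \<longrightarrow> circle_sign G js = -1) \<longleftrightarrow>
    (\<exists>(L :: ('v, 'e, 'i) ohg) (H :: ('v, 'e, 'i) ohg).
       is_L k L \<and> (extroverted L \<or> introverted L) \<and>
       balanced_subdivision L H \<and> switching_equivalent G H)"
proof
  assume "\<exists>(L :: ('v, 'e, 'i) ohg) (H :: ('v, 'e, 'i) ohg).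
       is_L k L \<and> (extroverted L \<or> introverted L) \<and>
       balanced_subdivision L H \<and> switching_equivalent G H"
  then obtain L H :: "('v, 'e, 'i) ohg" where L: "is_L k L" "extroverted L \<or> introverted L"
    and b: "balanced_subdivision L H" and sw: "switching_equivalent G H" by blast
  have sub: "subdivision L H" using b by (simp add: balanced_subdivision_def)
  show "\<forall>ns js. circle G ns js \<longrightarrow> circle_sign G js = -1"
  proof (intro allI impI)
    fix ns js assume c: "circle G ns js"
    then have cH: "circle H ns js" using switching_equivalent_circle[OF sw] by simp
    then obtain ns' i j where ij: "circle L ns' [i, j]" "{i, j} = set js \<inter> incs L"
        "i \<in> incs L" "j \<in> incs L"
      using subdivision_L_circle[OF L(1) sub cH] by blast
    have "circle_sign H js = circle_sign L [i, j]"
      using b cH ij(1,2) by (simp add: balanced_subdivision_def)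
    \<comment> \<open>The two incidences of \<open>L\<close> have equal signs, whose product is 1;
      the factor for two incidences is -1.\<close>
    also have "\<dots> = -1" using L(2) ij(3,4)
      by (auto simp: circle_sign_def extroverted_def introverted_def)
    finally show "circle_sign G js = -1" using switching_equivalent_sign[OF sw c] by simp
  qed
next
  assume neg: "\<forall>ns js. circle G ns js \<longrightarrow> circle_sign G js = -1"
  obtain x where x: "x \<in> verts G" "card (incs_vert G x) = k" "acyclic_off G x"
    "\<And>v. v \<in> verts G \<Longrightarrow> v \<noteq> x \<Longrightarrow> card (incs_vert G v) = 2" "card (edges G) = card (verts G)"
    using minimal_cross_theta_tree_off[OF assms(2)] by blast
  have oG: "oriented_hypergraph G" using assms(2) by (simp add: minimal_cross_theta_def)
  then have rng: "\<And>i. i \<in> incs G \<Longrightarrow> snd (incf G i) \<in> edges G" and fin: "finite (edges G)"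
    and ori: "\<And>i. i \<in> incs G \<Longrightarrow> orient G i = 1 \<or> orient G i = -1"
    by (auto simp: oriented_hypergraph_def mem_Times_iff)
  \<comment> \<open>Two such incidences form a circle whose sign is minus the product of their
    signs, so negativity makes these signs equal.\<close>
  have same: "orient G i = orient G j"
    if "i \<in> incs_vert G x" "j \<in> incs_vert G x" "snd (incf G i) = snd (incf G j)" for i j
  proof (cases "i = j")
    case False
    have "i \<in> incs G" "j \<in> incs G" "incf G i = incf G j"
      using that by (auto simp: incs_vert_def prod_eq_iff)
    then have "circle_sign G [i, j] = -1" using neg circle_two_incs[OF oG] False by blast
    then show ?thesis using ori[OF \<open>i \<in> incs G\<close>] ori[OF \<open>j \<in> incs G\<close>]
      by (auto simp: circle_sign_def)
  qed simp
  \<comment> \<open>\<open>F\<close> collects the edges with a negative incidence at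
    \<open>x\<close>. By \<open>same\<close>, all incidences at \<open>x\<close> with such an edge
    are negative, so switching \<open>F\<close> makes every incidence at \<open>x\<close>
    positive.\<close>
  define F where "F = (\<lambda>i. snd (incf G i)) ` {i \<in> incs_vert G x. orient G i = -1}"
  define f where "f = (\<lambda>i. if i \<in> incs G \<and> snd (incf G i) \<in> F then - orient G i else orient G i)"
  define H where "H = G\<lparr>orient := f\<rparr>"
  have F: "F \<subseteq> edges G" using rng by (auto simp: F_def incs_vert_def)
  then have sw: "switching_equivalent G H"
    using switch_edges[OF finite_subset[OF F fin] F] by (simp add: H_def f_def)
  have pos: "f i = 1" if "i \<in> incs_vert G x" for i
  proof -
    have "i \<in> incs G" using that by (simp add: incs_vert_def)
    moreover have "snd (incf G i) \<in> F \<longleftrightarrow> orient G i = -1"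
    proof
      assume "snd (incf G i) \<in> F"
      then obtain j where j: "j \<in> incs_vert G x" "orient G j = -1" "snd (incf G i) = snd (incf G j)"
        unfolding F_def by blast
      then show "orient G i = -1" using same[OF that j(1,3)] by simp
    next
      assume "orient G i = -1"
      then show "snd (incf G i) \<in> F" using that unfolding F_def by blast
    qed
    ultimately show ?thesis using ori[of i] by (auto simp: f_def)
  qed
  have "oriented_hypergraph H" using oG by (auto simp: H_def f_def oriented_hypergraph_def)
  then obtain L where L: "is_L k L" "incs L = incs_vert G x" "orient L = f" "subdivision L H"
    using tree_off_subdivision[of H x] x by (auto simp: H_def)
  have ext: "extroverted L" using L(2,3) pos by (auto simp: extroverted_def)
  \<comment> \<open>Signs agree because all circles on both sides are negative: in \<open>H\<close>
    by invariance under switching, in \<open>L\<close> because each circle consists of two positive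
    incidences, by \<open>subdivision_L_circle\<close> applied to the trivial subdivision.\<close>
  have "circle_sign H js' = circle_sign L js"
    if c: "circle L ns js" "circle H ns' js'" for ns js ns' js'
  proof -
    obtain ns'' i j where ij: "circle L ns'' [i, j]" "{i, j} = set js \<inter> incs L"
      using subdivision_L_circle[OF L(1) _ c(1)] by (auto simp: subdivision_def)
    have d: "distinct js" "i \<noteq> j" using c(1) ij(1) by (auto simp: circle_def)
    have "set js = {i, j}" using ij(2) circle_incs[OF c(1)] by auto
    then have "length js = 2" using d by (metis card_2_iff distinct_card)
    moreover have "(\<Prod>i\<leftarrow>js. orient L i) = (\<Prod>i\<leftarrow>js. 1)"
      using ext circle_incs[OF c(1)] by (intro arg_cong[of _ _ prod_list] map_cong) (auto simp: extroverted_def)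
    ultimately have "circle_sign L js = -1" by (simp add: circle_sign_def prod_list_replicate map_replicate_const)
    moreover have "circle G ns' js'" using c(2) switching_equivalent_circle[OF sw] by simp
    ultimately show ?thesis using neg switching_equivalent_sign[OF sw] by metis
  qed
  then have "balanced_subdivision L H" using L(4) unfolding balanced_subdivision_def by blast
  then show "\<exists>(L :: ('v, 'e, 'i) ohg) (H :: ('v, 'e, 'i) ohg).
       is_L k L \<and> (extroverted L \<or> introverted L) \<and>
       balanced_subdivision L H \<and> switching_equivalent G H"
    using L(1) ext sw by blast
qed

end
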